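(* Let $A$ be an associative algebra over a field $\mathbb{K}$ and let $r,s\in A\otimes A$. Define $\delta_r,\delta_s,\Delta:A\to A\otimes A$ by $$\delta_r(a)=ar-ra,\qquad \delta_s(a)=as-sa,\qquad \Delta(a)=ar-sa.$$ Then $(A,\delta_r,\delta_s,\Delta)$ is a covariant bialgebra if and only if, for all $a\in A$, $$a\,(r_{13}r_{12}-r_{12}r_{23}+s_{23}r_{13})=(s_{13}r_{12}-s_{12}s_{23}+s_{23}s_{13})\,a.$$
   Context: Algebras are associative, not necessarily unital; $\otimes=\otimes_{\mathbb{K}}$. $A\otimes A$ is an $A$-bimodule by $a\cdot(b\otimes c)\cdot d=ab\otimes cd$; similarly on $A\otimes A\otimes A$, $a$ acts from the left by left multiplication on the first factor and from the right by right multiplication on the last factor. For $r=\sum_i a_i\otimes b_i\in A\otimes A$ put $r_{12}=r\otimes 1$, $r_{13}=\sum_i a_i\otimes 1\otimes b_i$, $r_{23}=1\otimes r$, where $1$ is the identity of $A$ if $A$ is unital, or the identity of the extended unital algebra $\mathbb{K}\oplus A$ otherwise. A derivation $\delta:A\to A\otimes A$ is a $\mathbb{K}$-linear map with $\delta(ab)=a\delta(b)+\delta(a)b$. A covariant bialgebra is a quadruple $(A,\delta_1,\delta_2,\Delta)$ such that $A$ is an associative algebra, $\delta_1,\delta_2:A\to A\otimes A$ are derivations, and $\Delta:A\to A\otimes A$ is a $\mathbb{K}$-linear coassociative map (no counit is required) that is a covariant derivation with respect to $(\delta_1,\delta_2)$, i.e. for all $a,b\in A$, $$\Delta(ab)=\Delta(a)b+a\delta_1(b)=a\Delta(b)+\delta_2(a)b.$$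 *)

theory Defs
  imports Complex_Main "HOL-Library.Poly_Mapping" "HOL-Library.Product_Plus"
begin

section \<open>Free vector spaces\<close>

text \<open>
  The free vector space on the (elements of the) type \<open>'x\<close> is \<open>'x \<Rightarrow>\<^sub>0 'k\<close>;
  its basis vector at \<open>x\<close> is \<open>gen x\<close>.
\<close>

definition fsmult :: "'k::field \<Rightarrow> ('x \<Rightarrow>\<^sub>0 'k) \<Rightarrow> ('x \<Rightarrow>\<^sub>0 'k)" where
  "fsmult c p = Poly_Mapping.map ((*) c) p"

abbreviation gen :: "'x \<Rightarrow> ('x \<Rightarrow>\<^sub>0 'k::field)" where
  "gen x \<equiv> Poly_Mapping.single x 1"

lemma lookup_fsmult [simp]: "Poly_Mapping.lookup (fsmult c p) x = c * Poly_Mapping.lookup p x"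
  by (simp add: fsmult_def Poly_Mapping.map.rep_eq when_def)

lemma vector_space_fsmult: "vector_space fsmult"
  by unfold_locales (auto intro!: poly_mapping_eqI simp: lookup_add algebra_simps)

text \<open>The linear extension of a map given on basis vectors.\<close>

definition lin_ext :: "('x \<Rightarrow> ('y \<Rightarrow>\<^sub>0 'k)) \<Rightarrow> ('x \<Rightarrow>\<^sub>0 'k) \<Rightarrow> ('y \<Rightarrow>\<^sub>0 'k::field)" where
  "lin_ext g p = (\<Sum>x\<in>Poly_Mapping.keys p. fsmult (Poly_Mapping.lookup p x) (g x))"

section \<open>Quotient spaces\<close>

text \<open>
  Elements of the quotient of a free vector space by a subspace \<open>N\<close> are cosets.
  \<open>qlift N f\<close> and \<open>qlift2 N f\<close> are the maps induced on cosets by \<open>f\<close>, with values in the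
  quotient by \<open>N\<close>; whenever \<open>f\<close> respects the subspaces, the unions range over one single coset.
  They serve to avoid the built-in operations on sets: the minus sign on sets is set difference.
\<close>

definition coset :: "('x \<Rightarrow>\<^sub>0 'k::field) set \<Rightarrow> ('x \<Rightarrow>\<^sub>0 'k) \<Rightarrow> ('x \<Rightarrow>\<^sub>0 'k) set" where
  "coset N p = {q. q - p \<in> N}"

definition qlift :: "('y \<Rightarrow>\<^sub>0 'k::field) set \<Rightarrow> (('x \<Rightarrow>\<^sub>0 'k) \<Rightarrow> ('y \<Rightarrow>\<^sub>0 'k)) \<Rightarrow>
    ('x \<Rightarrow>\<^sub>0 'k) set \<Rightarrow> ('y \<Rightarrow>\<^sub>0 'k) set" where
  "qlift N f X = (\<Union>p\<in>X. coset N (f p))"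

definition qlift2 :: "('z \<Rightarrow>\<^sub>0 'k::field) set \<Rightarrow>
    (('x \<Rightarrow>\<^sub>0 'k) \<Rightarrow> ('y \<Rightarrow>\<^sub>0 'k) \<Rightarrow> ('z \<Rightarrow>\<^sub>0 'k)) \<Rightarrow>
    ('x \<Rightarrow>\<^sub>0 'k) set \<Rightarrow> ('y \<Rightarrow>\<^sub>0 'k) set \<Rightarrow> ('z \<Rightarrow>\<^sub>0 'k) set" where
  "qlift2 N f X Y = (\<Union>p\<in>X. \<Union>q\<in>Y. coset N (f p q))"

definition qadd :: "('x \<Rightarrow>\<^sub>0 'k::field) set \<Rightarrow> ('x \<Rightarrow>\<^sub>0 'k) set \<Rightarrow> ('x \<Rightarrow>\<^sub>0 'k) set \<Rightarrow> ('x \<Rightarrow>\<^sub>0 'k) set" where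
  "qadd N = qlift2 N (+)"

definition qdiff :: "('x \<Rightarrow>\<^sub>0 'k::field) set \<Rightarrow> ('x \<Rightarrow>\<^sub>0 'k) set \<Rightarrow> ('x \<Rightarrow>\<^sub>0 'k) set \<Rightarrow> ('x \<Rightarrow>\<^sub>0 'k) set" where
  "qdiff N = qlift2 N (-)"

definition qscale :: "('x \<Rightarrow>\<^sub>0 'k::field) set \<Rightarrow> 'k \<Rightarrow> ('x \<Rightarrow>\<^sub>0 'k) set \<Rightarrow> ('x \<Rightarrow>\<^sub>0 'k) set" where
  "qscale N c = qlift N (fsmult c)"

section \<open>Tensor products\<close>

text \<open>
  Throughout, \<open>scale\<close> is the scalar multiplication of a vector space \<open>'a\<close>.
  \<open>A \<otimes> A\<close> is the free vector space on \<open>A \<times> A\<close> modulo the relations expressing bilinearity of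
  \<open>(x, y) \<mapsto> gen (x, y)\<close>, and likewise for \<open>A \<otimes> A \<otimes> A\<close>. The set \<open>H\<close> below consists of the maps
  that insert an element at one place while the other entries stay fixed.
\<close>

definition multilin_rel ::
    "('k::field \<Rightarrow> 'a::ab_group_add \<Rightarrow> 'a) \<Rightarrow> ('a \<Rightarrow> 'x) set \<Rightarrow> ('x \<Rightarrow>\<^sub>0 'k) set" where
  "multilin_rel scale H = module.span fsmult
     ({gen (h (u + v)) - gen (h u) - gen (h v) | h u v. h \<in> H} \<union>
      {gen (h (scale c u)) - fsmult c (gen (h u)) | h c u. h \<in> H})"

definition rel2 :: "('k::field \<Rightarrow> 'a::ab_group_add \<Rightarrow> 'a) \<Rightarrow> ('a \<times> 'a \<Rightarrow>\<^sub>0 'k) set" where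
  "rel2 scale = multilin_rel scale (\<Union>x. {\<lambda>u. (u, x), \<lambda>u. (x, u)})"

definition rel3 :: "('k::field \<Rightarrow> 'a::ab_group_add \<Rightarrow> 'a) \<Rightarrow> ('a \<times> 'a \<times> 'a \<Rightarrow>\<^sub>0 'k) set" where
  "rel3 scale = multilin_rel scale (\<Union>x y. {\<lambda>u. (u, x, y), \<lambda>u. (x, u, y), \<lambda>u. (x, y, u)})"

definition tensor2 :: "('k::field \<Rightarrow> 'a::ab_group_add \<Rightarrow> 'a) \<Rightarrow> ('a \<times> 'a \<Rightarrow>\<^sub>0 'k) set set" where
  "tensor2 scale = range (coset (rel2 scale))"

section \<open>Algebras, their unital extension, and the bimodule structures\<close>

text \<open>Associative algebras, not necessarily unital.\<close>

locale assoc_algebra = vector_space scale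
  for scale :: "'k::field \<Rightarrow> 'a::ab_group_add \<Rightarrow> 'a" +
  fixes mul :: "'a \<Rightarrow> 'a \<Rightarrow> 'a"
  assumes mul_assoc: "mul (mul x y) z = mul x (mul y z)"
    and mul_add_left: "mul (x + y) z = mul x z + mul y z"
    and mul_add_right: "mul x (y + z) = mul x y + mul x z"
    and mul_scale_left: "mul (scale c x) y = scale c (mul x y)"
    and mul_scale_right: "mul x (scale c y) = scale c (mul x y)"

definition is_identity :: "('a \<Rightarrow> 'a \<Rightarrow> 'a) \<Rightarrow> 'a \<Rightarrow> bool" where
  "is_identity mul e \<longleftrightarrow> (\<forall>x. mul e x = x \<and> mul x e = x)"

definition unital :: "('a \<Rightarrow> 'a \<Rightarrow> 'a) \<Rightarrow> bool" where
  "unital mul \<longleftrightarrow> (\<exists>e. is_identity mul e)"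

definition identity :: "('a \<Rightarrow> 'a \<Rightarrow> 'a) \<Rightarrow> 'a" where
  "identity mul = (THE e. is_identity mul e)"

text \<open>
  The extended algebra \<open>K \<oplus> A\<close>, with identity \<open>(1, 0)\<close> and containing \<open>A\<close> as the elements
  \<open>(0, a)\<close>; \<open>ext_embed2\<close> is the induced map from \<open>A \<otimes> A\<close> to \<open>(K \<oplus> A) \<otimes> (K \<oplus> A)\<close>.
\<close>

definition ext_scale :: "('k::field \<Rightarrow> 'a::ab_group_add \<Rightarrow> 'a) \<Rightarrow> 'k \<Rightarrow> 'k \<times> 'a \<Rightarrow> 'k \<times> 'a" where
  "ext_scale scale c = (\<lambda>(k, x). (c * k, scale c x))"

definition ext_mul :: "('k::field \<Rightarrow> 'a::ab_group_add \<Rightarrow> 'a) \<Rightarrow> ('a \<Rightarrow> 'a \<Rightarrow> 'a) \<Rightarrow>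
    'k \<times> 'a \<Rightarrow> 'k \<times> 'a \<Rightarrow> 'k \<times> 'a" where
  "ext_mul scale mul = (\<lambda>(k, x) (l, y). (k * l, scale k y + scale l x + mul x y))"

definition ext_embed2 :: "('k::field \<Rightarrow> 'a::ab_group_add \<Rightarrow> 'a) \<Rightarrow>
    ('a \<times> 'a \<Rightarrow>\<^sub>0 'k) set \<Rightarrow> (('k \<times> 'a) \<times> ('k \<times> 'a) \<Rightarrow>\<^sub>0 'k) set" where
  "ext_embed2 scale = qlift (rel2 (ext_scale scale)) (lin_ext (\<lambda>(x, y). gen ((0, x), (0, y))))"

definition lact2 :: "('k::field \<Rightarrow> 'a::ab_group_add \<Rightarrow> 'a) \<Rightarrow> ('a \<Rightarrow> 'a \<Rightarrow> 'a) \<Rightarrow>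
    'a \<Rightarrow> ('a \<times> 'a \<Rightarrow>\<^sub>0 'k) set \<Rightarrow> ('a \<times> 'a \<Rightarrow>\<^sub>0 'k) set" where
  "lact2 scale mul a = qlift (rel2 scale) (lin_ext (\<lambda>(x, y). gen (mul a x, y)))"

definition ract2 :: "('k::field \<Rightarrow> 'a::ab_group_add \<Rightarrow> 'a) \<Rightarrow> ('a \<Rightarrow> 'a \<Rightarrow> 'a) \<Rightarrow>
    ('a \<times> 'a \<Rightarrow>\<^sub>0 'k) set \<Rightarrow> 'a \<Rightarrow> ('a \<times> 'a \<Rightarrow>\<^sub>0 'k) set" where
  "ract2 scale mul X a = qlift (rel2 scale) (lin_ext (\<lambda>(x, y). gen (x, mul y a))) X"

definition lact3 :: "('k::field \<Rightarrow> 'a::ab_group_add \<Rightarrow> 'a) \<Rightarrow> ('a \<Rightarrow> 'a \<Rightarrow> 'a) \<Rightarrow>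
    'a \<Rightarrow> ('a \<times> 'a \<times> 'a \<Rightarrow>\<^sub>0 'k) set \<Rightarrow> ('a \<times> 'a \<times> 'a \<Rightarrow>\<^sub>0 'k) set" where
  "lact3 scale mul a = qlift (rel3 scale) (lin_ext (\<lambda>(x, y, z). gen (mul a x, y, z)))"

definition ract3 :: "('k::field \<Rightarrow> 'a::ab_group_add \<Rightarrow> 'a) \<Rightarrow> ('a \<Rightarrow> 'a \<Rightarrow> 'a) \<Rightarrow>
    ('a \<times> 'a \<times> 'a \<Rightarrow>\<^sub>0 'k) set \<Rightarrow> 'a \<Rightarrow> ('a \<times> 'a \<times> 'a \<Rightarrow>\<^sub>0 'k) set" where
  "ract3 scale mul X a = qlift (rel3 scale) (lin_ext (\<lambda>(x, y, z). gen (x, y, mul z a))) X"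

definition tmul3 :: "('k::field \<Rightarrow> 'a::ab_group_add \<Rightarrow> 'a) \<Rightarrow> ('a \<Rightarrow> 'a \<Rightarrow> 'a) \<Rightarrow>
    ('a \<times> 'a \<times> 'a \<Rightarrow>\<^sub>0 'k) set \<Rightarrow> ('a \<times> 'a \<times> 'a \<Rightarrow>\<^sub>0 'k) set \<Rightarrow> ('a \<times> 'a \<times> 'a \<Rightarrow>\<^sub>0 'k) set" where
  "tmul3 scale mul = qlift2 (rel3 scale)
     (\<lambda>p q. lin_ext (\<lambda>(x, y, z). lin_ext (\<lambda>(u, v, w). gen (mul x u, mul y v, mul z w)) q) p)"

section \<open>Covariant bialgebras\<close>

definition tensor2_linear :: "('k::field \<Rightarrow> 'a::ab_group_add \<Rightarrow> 'a) \<Rightarrow>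
    ('a \<Rightarrow> ('a \<times> 'a \<Rightarrow>\<^sub>0 'k) set) \<Rightarrow> bool" where
  "tensor2_linear scale f \<longleftrightarrow>
     (\<forall>a. f a \<in> tensor2 scale) \<and>
     (\<forall>a b. f (a + b) = qadd (rel2 scale) (f a) (f b)) \<and>
     (\<forall>c a. f (scale c a) = qscale (rel2 scale) c (f a))"

definition derivation :: "('k::field \<Rightarrow> 'a::ab_group_add \<Rightarrow> 'a) \<Rightarrow> ('a \<Rightarrow> 'a \<Rightarrow> 'a) \<Rightarrow>
    ('a \<Rightarrow> ('a \<times> 'a \<Rightarrow>\<^sub>0 'k) set) \<Rightarrow> bool" where
  "derivation scale mul \<delta> \<longleftrightarrow> tensor2_linear scale \<delta> \<and>
     (\<forall>a b. \<delta> (mul a b) = qadd (rel2 scale) (lact2 scale mul a (\<delta> b)) (ract2 scale mul (\<delta> a) b))"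

definition covariant_derivation :: "('k::field \<Rightarrow> 'a::ab_group_add \<Rightarrow> 'a) \<Rightarrow> ('a \<Rightarrow> 'a \<Rightarrow> 'a) \<Rightarrow>
    ('a \<Rightarrow> ('a \<times> 'a \<Rightarrow>\<^sub>0 'k) set) \<Rightarrow> ('a \<Rightarrow> ('a \<times> 'a \<Rightarrow>\<^sub>0 'k) set) \<Rightarrow>
    ('a \<Rightarrow> ('a \<times> 'a \<Rightarrow>\<^sub>0 'k) set) \<Rightarrow> bool" where
  "covariant_derivation scale mul \<delta>\<^sub>1 \<delta>\<^sub>2 \<Delta> \<longleftrightarrow> (\<forall>a b.
     \<Delta> (mul a b) = qadd (rel2 scale) (ract2 scale mul (\<Delta> a) b) (lact2 scale mul a (\<delta>\<^sub>1 b)) \<and>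
     \<Delta> (mul a b) = qadd (rel2 scale) (lact2 scale mul a (\<Delta> b)) (ract2 scale mul (\<delta>\<^sub>2 a) b))"

text \<open>
  \<open>\<Delta> \<otimes> id\<close> and \<open>id \<otimes> \<Delta>\<close> as maps from \<open>A \<otimes> A\<close> to \<open>A \<otimes> A \<otimes> A\<close>. On generators, \<open>\<Delta> x \<otimes> y\<close> is
  computed from an arbitrary representative of the coset \<open>\<Delta> x\<close>; the result modulo \<open>rel3\<close> does
  not depend on this choice.
\<close>

definition rep :: "('x \<Rightarrow>\<^sub>0 'k::field) set \<Rightarrow> ('x \<Rightarrow>\<^sub>0 'k)" where
  "rep X = (SOME p. p \<in> X)"

definition apply_left :: "('k::field \<Rightarrow> 'a::ab_group_add \<Rightarrow> 'a) \<Rightarrow>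
    ('a \<Rightarrow> ('a \<times> 'a \<Rightarrow>\<^sub>0 'k) set) \<Rightarrow> ('a \<times> 'a \<Rightarrow>\<^sub>0 'k) set \<Rightarrow> ('a \<times> 'a \<times> 'a \<Rightarrow>\<^sub>0 'k) set" where
  "apply_left scale \<Delta> = qlift (rel3 scale)
     (lin_ext (\<lambda>(x, y). lin_ext (\<lambda>(u, v). gen (u, v, y)) (rep (\<Delta> x))))"

definition apply_right :: "('k::field \<Rightarrow> 'a::ab_group_add \<Rightarrow> 'a) \<Rightarrow>
    ('a \<Rightarrow> ('a \<times> 'a \<Rightarrow>\<^sub>0 'k) set) \<Rightarrow> ('a \<times> 'a \<Rightarrow>\<^sub>0 'k) set \<Rightarrow> ('a \<times> 'a \<times> 'a \<Rightarrow>\<^sub>0 'k) set" where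
  "apply_right scale \<Delta> = qlift (rel3 scale)
     (lin_ext (\<lambda>(x, y). lin_ext (\<lambda>(u, v). gen (x, u, v)) (rep (\<Delta> y))))"

definition coassociative :: "('k::field \<Rightarrow> 'a::ab_group_add \<Rightarrow> 'a) \<Rightarrow>
    ('a \<Rightarrow> ('a \<times> 'a \<Rightarrow>\<^sub>0 'k) set) \<Rightarrow> bool" where
  "coassociative scale \<Delta> \<longleftrightarrow> (\<forall>a. apply_left scale \<Delta> (\<Delta> a) = apply_right scale \<Delta> (\<Delta> a))"

definition covariant_bialgebra :: "('k::field \<Rightarrow> 'a::ab_group_add \<Rightarrow> 'a) \<Rightarrow> ('a \<Rightarrow> 'a \<Rightarrow> 'a) \<Rightarrow>
    ('a \<Rightarrow> ('a \<times> 'a \<Rightarrow>\<^sub>0 'k) set) \<Rightarrow> ('a \<Rightarrow> ('a \<times> 'a \<Rightarrow>\<^sub>0 'k) set) \<Rightarrow>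
    ('a \<Rightarrow> ('a \<times> 'a \<Rightarrow>\<^sub>0 'k) set) \<Rightarrow> bool" where
  "covariant_bialgebra scale mul \<delta>\<^sub>1 \<delta>\<^sub>2 \<Delta> \<longleftrightarrow>
     assoc_algebra scale mul \<and>
     derivation scale mul \<delta>\<^sub>1 \<and> derivation scale mul \<delta>\<^sub>2 \<and>
     tensor2_linear scale \<Delta> \<and> coassociative scale \<Delta> \<and>
     covariant_derivation scale mul \<delta>\<^sub>1 \<delta>\<^sub>2 \<Delta>"

section \<open>The compatibility equation\<close>

text \<open>
  In the following, \<open>e\<close> is the identity of a unital algebra \<open>B\<close>, and \<open>r, s \<in> B \<otimes> B\<close>.
\<close>

definition leg12 :: "('k::field \<Rightarrow> 'b::ab_group_add \<Rightarrow> 'b) \<Rightarrow> 'b \<Rightarrow>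
    ('b \<times> 'b \<Rightarrow>\<^sub>0 'k) set \<Rightarrow> ('b \<times> 'b \<times> 'b \<Rightarrow>\<^sub>0 'k) set" where
  "leg12 scale e = qlift (rel3 scale) (lin_ext (\<lambda>(x, y). gen (x, y, e)))"

definition leg13 :: "('k::field \<Rightarrow> 'b::ab_group_add \<Rightarrow> 'b) \<Rightarrow> 'b \<Rightarrow>
    ('b \<times> 'b \<Rightarrow>\<^sub>0 'k) set \<Rightarrow> ('b \<times> 'b \<times> 'b \<Rightarrow>\<^sub>0 'k) set" where
  "leg13 scale e = qlift (rel3 scale) (lin_ext (\<lambda>(x, y). gen (x, e, y)))"

definition leg23 :: "('k::field \<Rightarrow> 'b::ab_group_add \<Rightarrow> 'b) \<Rightarrow> 'b \<Rightarrow>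
    ('b \<times> 'b \<Rightarrow>\<^sub>0 'k) set \<Rightarrow> ('b \<times> 'b \<times> 'b \<Rightarrow>\<^sub>0 'k) set" where
  "leg23 scale e = qlift (rel3 scale) (lin_ext (\<lambda>(x, y). gen (e, x, y)))"

definition compatible :: "('k::field \<Rightarrow> 'b::ab_group_add \<Rightarrow> 'b) \<Rightarrow> ('b \<Rightarrow> 'b \<Rightarrow> 'b) \<Rightarrow> 'b \<Rightarrow>
    ('b \<times> 'b \<Rightarrow>\<^sub>0 'k) set \<Rightarrow> ('b \<times> 'b \<Rightarrow>\<^sub>0 'k) set \<Rightarrow> 'b \<Rightarrow> bool" where
  "compatible scale mul e r s a \<longleftrightarrow>
     (let add = qadd (rel3 scale); diff = qdiff (rel3 scale); times = tmul3 scale mul;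
          r12 = leg12 scale e r; r13 = leg13 scale e r; r23 = leg23 scale e r;
          s12 = leg12 scale e s; s13 = leg13 scale e s; s23 = leg23 scale e s
      in lact3 scale mul a (add (diff (times r13 r12) (times r12 r23)) (times s23 r13))
       = ract3 scale mul (add (diff (times s13 r12) (times s12 s23)) (times s23 s13)) a)"

end

theory Submission
  imports Defs
begin

text \<open>
  The maps \<open>\<delta>\<^sub>r\<close>, \<open>\<delta>\<^sub>s\<close> are always derivations and \<open>\<Delta>\<close> is always a covariant derivation,
  so only coassociativity is at stake. Expanding gives
  \<open>(\<Delta> \<otimes> id) \<Delta>(a) = a r\<^sub>1\<^sub>3 r\<^sub>1\<^sub>2 - M - s\<^sub>1\<^sub>3 r\<^sub>1\<^sub>2 a + s\<^sub>1\<^sub>2 s\<^sub>2\<^sub>3 a\<close> and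
  \<open>(id \<otimes> \<Delta>) \<Delta>(a) = a r\<^sub>1\<^sub>2 r\<^sub>2\<^sub>3 - a s\<^sub>2\<^sub>3 r\<^sub>1\<^sub>3 - M + s\<^sub>2\<^sub>3 s\<^sub>1\<^sub>3 a\<close> with the same mixed term
  \<open>M = s\<^sub>1\<^sub>2 (1 \<otimes> a \<otimes> 1) r\<^sub>2\<^sub>3\<close>. The difference of the two sides is therefore the difference of the two
  sides of the compatibility equation. If \<open>A\<close> has no identity, the equation lives over
  \<open>K \<oplus> A\<close>, but both its sides come from \<open>A \<otimes> A \<otimes> A\<close>, which embeds because \<open>A\<close> is a linear
  retract of \<open>K \<oplus> A\<close>. On representatives in the free vector spaces these identities hold
  exactly, not only modulo the multilinearity relations.
\<close>

section \<open>Linear extensions\<close>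

interpretation fs: vector_space fsmult
  by (rule vector_space_fsmult)

text \<open>Keys outside the support have coefficient 0. A common index set makes the sums for
  different arguments comparable.\<close>

lemma lin_ext_superset:
  assumes "finite S" "Poly_Mapping.keys p \<subseteq> S"
  shows "lin_ext g p = (\<Sum>x\<in>S. fsmult (Poly_Mapping.lookup p x) (g x))"
  unfolding lin_ext_def
  by (rule sum.mono_neutral_left) (use assms in \<open>auto simp: in_keys_iff\<close>)

lemma lin_ext_add [simp]: "lin_ext g (p + q) = lin_ext g p + lin_ext g q"
proof -
  let ?S = "Poly_Mapping.keys p \<union> Poly_Mapping.keys q"
  have "Poly_Mapping.keys (p + q) \<subseteq> ?S"
    by (rule Poly_Mapping.keys_add)
  then show ?thesis
    by (simp add: lin_ext_superset[of ?S] lookup_add fs.scale_left_distrib sum.distrib)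
qed

lemma lin_ext_fsmult [simp]: "lin_ext g (fsmult c p) = fsmult c (lin_ext g p)"
proof -
  have "Poly_Mapping.keys (fsmult c p) \<subseteq> Poly_Mapping.keys p"
    by (auto simp: in_keys_iff)
  then show ?thesis
    by (simp add: lin_ext_superset[of "Poly_Mapping.keys p"] fs.scale_sum_right)
qed

interpretation lin_ext: Vector_Spaces.linear fsmult fsmult "lin_ext g" for g
  by unfold_locales simp_all

lemma lin_ext_diff [simp]: "lin_ext g (p - q) = lin_ext g p - lin_ext g q"
  by (rule lin_ext.diff)

lemma lin_ext_gen [simp]: "lin_ext g (gen x) = g x"
  by (simp add: lin_ext_def)

lemma lin_ext_gen_id [simp]: "lin_ext gen p = (p :: 'x \<Rightarrow>\<^sub>0 'k::field)"
proof (rule poly_mapping_eqI)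
  fix x
  have "Poly_Mapping.lookup (lin_ext gen p) x
      = (\<Sum>y\<in>Poly_Mapping.keys p. Poly_Mapping.lookup p y when y = x)"
    by (simp add: lin_ext_def lookup_sum lookup_single when_def if_distrib cong: if_cong)
  also have "\<dots> = Poly_Mapping.lookup p x"
    by (simp add: when_def in_keys_iff)
  finally show "Poly_Mapping.lookup (lin_ext gen p) x = Poly_Mapping.lookup p x" .
qed

lemma lin_ext_lin_ext [simp]: "lin_ext g (lin_ext f p) = lin_ext (\<lambda>x. lin_ext g (f x)) p"
  by (simp add: lin_ext_def[of f] lin_ext_def[of "\<lambda>x. lin_ext g (f x)"] lin_ext.sum)

lemma lin_ext_fun_diff: "lin_ext (\<lambda>x. f x - g x) p = lin_ext f p - lin_ext g p"
  by (simp add: lin_ext_def fs.scale_right_diff_distrib sum_subtractf)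

lemma lin_ext_fun_fsmult: "lin_ext (\<lambda>x. fsmult c (f x)) p = fsmult c (lin_ext f p)"
  by (simp add: lin_ext_def fs.scale_sum_right mult.commute)

text \<open>Both sides are the same finite double sum over pairs of keys. This matches products of
  tensors whose sums are nested in opposite orders.\<close>

lemma lin_ext_swap:
  "lin_ext (\<lambda>x. lin_ext (f x) q) p = lin_ext (\<lambda>y. lin_ext (\<lambda>x. f x y) p) q"
proof -
  have "lin_ext (\<lambda>x. lin_ext (f x) q) p
      = (\<Sum>x\<in>Poly_Mapping.keys p. \<Sum>y\<in>Poly_Mapping.keys q.
           fsmult (Poly_Mapping.lookup p x * Poly_Mapping.lookup q y) (f x y))"
    by (simp add: lin_ext_def fs.scale_sum_right)
  also have "\<dots> = (\<Sum>y\<in>Poly_Mapping.keys q. \<Sum>x\<in>Poly_Mapping.keys p.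
           fsmult (Poly_Mapping.lookup q y * Poly_Mapping.lookup p x) (f x y))"
    by (subst sum.swap) (simp add: mult.commute)
  also have "\<dots> = lin_ext (\<lambda>y. lin_ext (\<lambda>x. f x y) p) q"
    by (simp add: lin_ext_def fs.scale_sum_right)
  finally show ?thesis .
qed

lemma lin_ext_mem:
  assumes "fs.subspace N" "\<And>x. f x \<in> N"
  shows "lin_ext f p \<in> N"
  unfolding lin_ext_def using assms by (intro fs.subspace_sum fs.subspace_scale)

lemma lin_ext_cong_mod:
  assumes "fs.subspace N" "\<And>x. f x - g x \<in> N"
  shows "lin_ext f p - lin_ext g p \<in> N"
  using lin_ext_mem[of N "\<lambda>x. f x - g x"] assms by (simp add: lin_ext_fun_diff)

section \<open>Cosets\<close>

lemma coset_eq_iff: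
  assumes "fs.subspace N"
  shows "coset N p = coset N q \<longleftrightarrow> p - q \<in> N"
proof
  assume "coset N p = coset N q"
  moreover have "p \<in> coset N p"
    using assms by (simp add: coset_def fs.subspace_0)
  ultimately show "p - q \<in> N"
    by (simp add: coset_def)
next
  assume *: "p - q \<in> N"
  have "x - q \<in> N \<longleftrightarrow> x - p \<in> N" for x
    using fs.subspace_add[OF assms, of "x - p" "p - q"]
      fs.subspace_diff[OF assms, of "x - q" "p - q"] * by (auto simp: algebra_simps)
  then show "coset N p = coset N q"
    by (simp add: coset_def)
qed

lemma rep_coset_mem:
  assumes "fs.subspace N"
  shows "rep (coset N p) - p \<in> N"
proof -
  have "p \<in> coset N p"
    using assms by (simp add: coset_def fs.subspace_0)
  then have "rep (coset N p) \<in> coset N p"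
    unfolding rep_def by (rule someI)
  then show ?thesis
    by (simp add: coset_def)
qed

text \<open>By the last assumption all cosets in the union coincide, and the union is nonempty
  because \<open>p\<close> and \<open>q\<close> lie in their own cosets.\<close>

lemma qlift2_coset:
  assumes "fs.subspace M" "fs.subspace M'" "fs.subspace N"
    and "\<And>p' q'. p' - p \<in> M \<Longrightarrow> q' - q \<in> M' \<Longrightarrow> f p' q' - f p q \<in> N"
  shows "qlift2 N f (coset M p) (coset M' q) = coset N (f p q)"
proof -
  have "coset N (f p' q') = coset N (f p q)" if "p' \<in> coset M p" "q' \<in> coset M' q" for p' q'
    using that assms by (simp add: coset_eq_iff) (simp add: coset_def)
  moreover have "p \<in> coset M p" "q \<in> coset M' q"
    using assms by (simp_all add: coset_def fs.subspace_0)
  ultimately show ?thesis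
    unfolding qlift2_def by blast
qed

lemma qlift_coset:
  assumes "fs.subspace M" "fs.subspace N" "\<And>p'. p' - p \<in> M \<Longrightarrow> f p' - f p \<in> N"
  shows "qlift N f (coset M p) = coset N (f p)"
proof -
  have "coset N (f p') = coset N (f p)" if "p' \<in> coset M p" for p'
    using that assms by (simp add: coset_eq_iff) (simp add: coset_def)
  moreover have "p \<in> coset M p"
    using assms by (simp add: coset_def fs.subspace_0)
  ultimately show ?thesis
    unfolding qlift_def by blast
qed

text \<open>For a linear map, independence of the representative amounts to mapping \<open>M\<close>
  into \<open>N\<close>, since only the difference \<open>p' - p\<close> matters.\<close>

lemma qlift_lin_ext_coset:
  assumes "fs.subspace M" "fs.subspace N" "\<And>t. t \<in> M \<Longrightarrow> lin_ext g t \<in> N"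
  shows "qlift N (lin_ext g) (coset M p) = coset N (lin_ext g p)"
  by (rule qlift_coset) (use assms in \<open>simp_all flip: lin_ext_diff\<close>)

lemma qadd_coset:
  assumes "fs.subspace N"
  shows "qadd N (coset N p) (coset N q) = coset N (p + q)"
  unfolding qadd_def
proof (rule qlift2_coset[OF assms assms assms])
  fix p' q'
  assume "p' - p \<in> N" "q' - q \<in> N"
  then have "(p' - p) + (q' - q) \<in> N"
    by (rule fs.subspace_add[OF assms])
  then show "p' + q' - (p + q) \<in> N"
    by (simp add: algebra_simps)
qed

lemma qdiff_coset:
  assumes "fs.subspace N"
  shows "qdiff N (coset N p) (coset N q) = coset N (p - q)"
  unfolding qdiff_def
proof (rule qlift2_coset[OF assms assms assms])
  fix p' q'
  assume "p' - p \<in> N" "q' - q \<in> N"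
  then have "(p' - p) - (q' - q) \<in> N"
    by (rule fs.subspace_diff[OF assms])
  then show "p' - q' - (p - q) \<in> N"
    by (simp add: algebra_simps)
qed

lemma qscale_coset:
  assumes "fs.subspace N"
  shows "qscale N c (coset N p) = coset N (fsmult c p)"
  unfolding qscale_def
  by (rule qlift_coset[OF assms assms])
    (use fs.subspace_scale[OF assms] in \<open>simp flip: fs.scale_right_diff_distrib\<close>)

section \<open>Maps that are linear modulo a subspace\<close>

text \<open>Says that \<open>f\<close> followed by the quotient map modulo \<open>N\<close> is
  linear, phrased on representatives.\<close>

definition linear_mod ::
    "('k::field \<Rightarrow> 'a::ab_group_add \<Rightarrow> 'a) \<Rightarrow> ('x \<Rightarrow>\<^sub>0 'k) set \<Rightarrow> ('a \<Rightarrow> ('x \<Rightarrow>\<^sub>0 'k)) \<Rightarrow> bool" where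
  "linear_mod scale N f \<longleftrightarrow>
     (\<forall>u v. f (u + v) - f u - f v \<in> N) \<and> (\<forall>c u. f (scale c u) - fsmult c (f u) \<in> N)"

lemma linear_mod_diff:
  assumes N: "fs.subspace N" and "linear_mod scale N f" "linear_mod scale N g"
  shows "linear_mod scale N (\<lambda>u. f u - g u)"
proof -
  have "(f (u + v) - f u - f v) - (g (u + v) - g u - g v) \<in> N"
    "(f (scale c u) - fsmult c (f u)) - (g (scale c u) - fsmult c (g u)) \<in> N" for u v c
    using assms(2,3) by (simp_all add: linear_mod_def fs.subspace_diff[OF N])
  then show ?thesis
    by (simp add: linear_mod_def algebra_simps)
qed

lemma linear_mod_lin_ext:
  assumes N: "fs.subspace N" and f: "\<And>x. linear_mod scale N (\<lambda>u. f u x)"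
  shows "linear_mod scale N (\<lambda>u. lin_ext (f u) p)"
proof -
  have "lin_ext (\<lambda>x. f (u + v) x - f u x - f v x) p \<in> N"
    "lin_ext (\<lambda>x. f (scale c u) x - fsmult c (f u x)) p \<in> N" for u v c
    by (rule lin_ext_mem[OF N], use f in \<open>simp add: linear_mod_def\<close>)+
  then show ?thesis
    by (simp add: linear_mod_def lin_ext_fun_diff lin_ext_fun_fsmult)
qed

lemma subspace_multilin_rel: "fs.subspace (multilin_rel scale H)"
  unfolding multilin_rel_def by (rule fs.subspace_span)

lemma subspace_rel2 [simp]: "fs.subspace (rel2 scale)"
  unfolding rel2_def by (rule subspace_multilin_rel)

lemma subspace_rel3 [simp]: "fs.subspace (rel3 scale)"
  unfolding rel3_def by (rule subspace_multilin_rel)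

text \<open>After linearity moves sums and scalars out of \<open>\<phi>\<close>, the required
  differences are themselves generators of the relation space.\<close>

lemma linear_mod_gen_multilin_rel:
  assumes "Vector_Spaces.linear scale scale' \<phi>" "h \<in> H"
  shows "linear_mod scale (multilin_rel scale' H) (\<lambda>u. gen (h (\<phi> u)))"
proof -
  interpret \<phi>: Vector_Spaces.linear scale scale' \<phi>
    by (rule assms)
  show ?thesis
    unfolding linear_mod_def multilin_rel_def \<phi>.add \<phi>.scale
    using assms(2) by (blast intro: fs.span_base)
qed

lemma linear_mod_gen_rel2:
  assumes "Vector_Spaces.linear scale scale' \<phi>"
  shows "linear_mod scale (rel2 scale') (\<lambda>u. gen (\<phi> u, x))"
    "linear_mod scale (rel2 scale') (\<lambda>u. gen (x, \<phi> u))"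
  unfolding rel2_def
  by (rule linear_mod_gen_multilin_rel[OF assms, of "\<lambda>u. (u, x)"], blast,
      rule linear_mod_gen_multilin_rel[OF assms, of "\<lambda>u. (x, u)"], blast)

lemma linear_mod_gen_rel3:
  assumes "Vector_Spaces.linear scale scale' \<phi>"
  shows "linear_mod scale (rel3 scale') (\<lambda>u. gen (\<phi> u, x, y))"
    "linear_mod scale (rel3 scale') (\<lambda>u. gen (x, \<phi> u, y))"
    "linear_mod scale (rel3 scale') (\<lambda>u. gen (x, y, \<phi> u))"
  unfolding rel3_def
  by (rule linear_mod_gen_multilin_rel[OF assms, of "\<lambda>u. (u, x, y)"], blast,
      rule linear_mod_gen_multilin_rel[OF assms, of "\<lambda>u. (x, u, y)"], blast,
      rule linear_mod_gen_multilin_rel[OF assms, of "\<lambda>u. (x, y, u)"], blast)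

text \<open>This is the universal property of the tensor product: the preimage of \<open>N\<close>
  under \<open>lin_ext g\<close> is a subspace, and multilinearity of \<open>g\<close> modulo
  \<open>N\<close> puts every generating relation into it.\<close>

lemma lin_ext_multilin_rel:
  assumes N: "fs.subspace N" and g: "\<And>h. h \<in> H \<Longrightarrow> linear_mod scale N (\<lambda>u. g (h u))"
    and t: "t \<in> multilin_rel scale H"
  shows "lin_ext g t \<in> N"
proof -
  let ?R = "{gen (h (u + v)) - gen (h u) - gen (h v) | h u v. h \<in> H} \<union>
      {gen (h (scale c u)) - fsmult c (gen (h u)) | h c u. h \<in> H}"
  have "fs.subspace {t. lin_ext g t \<in> N}"
    using N by (auto simp: fs.subspace_def lin_ext_def[of g 0])
  moreover have "?R \<subseteq> {t. lin_ext g t \<in> N}"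
    using g by (auto simp: linear_mod_def)
  ultimately have "fs.span ?R \<subseteq> {t. lin_ext g t \<in> N}"
    by (intro fs.span_minimal)
  then show ?thesis
    using t unfolding multilin_rel_def by blast
qed

lemma lin_ext_rel2:
  assumes "fs.subspace N"
    and "\<And>x. linear_mod scale N (\<lambda>u. g (u, x))" "\<And>x. linear_mod scale N (\<lambda>u. g (x, u))"
    and "t \<in> rel2 scale"
  shows "lin_ext g t \<in> N"
  by (rule lin_ext_multilin_rel[OF assms(1) _ assms(4)[unfolded rel2_def]]) (use assms in auto)

lemma lin_ext_rel3:
  assumes "fs.subspace N"
    and "\<And>x y. linear_mod scale N (\<lambda>u. g (u, x, y))" "\<And>x y. linear_mod scale N (\<lambda>u. g (x, u, y))"
      "\<And>x y. linear_mod scale N (\<lambda>u. g (x, y, u))"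
    and "t \<in> rel3 scale"
  shows "lin_ext g t \<in> N"
  by (rule lin_ext_multilin_rel[OF assms(1) _ assms(5)[unfolded rel3_def]]) (use assms in auto)

section \<open>Representatives of the bialgebra operations\<close>

context assoc_algebra
begin

text \<open>These are the choices of \<open>\<phi>\<close> with which entries of a generator are
  formed from the varying argument.\<close>

lemma linear_maps:
  "Vector_Spaces.linear scale scale (\<lambda>u. u)"
  "Vector_Spaces.linear scale scale (\<lambda>u. mul a u)"
  "Vector_Spaces.linear scale scale (\<lambda>u. mul u a)"
  by (unfold Vector_Spaces.linear_iff)
    (simp_all add: vector_space_axioms mul_add_left mul_add_right mul_scale_left mul_scale_right)

lemmas linear_mod_intros =
  linear_mod_diff linear_mod_lin_ext linear_mod_gen_rel2 linear_mod_gen_rel3 linear_maps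
  subspace_rel2 subspace_rel3

definition lmul2 :: "'a \<Rightarrow> ('a \<times> 'a \<Rightarrow>\<^sub>0 'k) \<Rightarrow> ('a \<times> 'a \<Rightarrow>\<^sub>0 'k)" where
  "lmul2 a = lin_ext (\<lambda>(x, y). gen (mul a x, y))"

definition rmul2 :: "'a \<Rightarrow> ('a \<times> 'a \<Rightarrow>\<^sub>0 'k) \<Rightarrow> ('a \<times> 'a \<Rightarrow>\<^sub>0 'k)" where
  "rmul2 a = lin_ext (\<lambda>(x, y). gen (x, mul y a))"

definition lmul3 :: "'a \<Rightarrow> ('a \<times> 'a \<times> 'a \<Rightarrow>\<^sub>0 'k) \<Rightarrow> ('a \<times> 'a \<times> 'a \<Rightarrow>\<^sub>0 'k)" where
  "lmul3 a = lin_ext (\<lambda>(x, y, z). gen (mul a x, y, z))"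

definition rmul3 :: "'a \<Rightarrow> ('a \<times> 'a \<times> 'a \<Rightarrow>\<^sub>0 'k) \<Rightarrow> ('a \<times> 'a \<times> 'a \<Rightarrow>\<^sub>0 'k)" where
  "rmul3 a = lin_ext (\<lambda>(x, y, z). gen (x, y, mul z a))"

definition mul3 ::
    "('a \<times> 'a \<times> 'a \<Rightarrow>\<^sub>0 'k) \<Rightarrow> ('a \<times> 'a \<times> 'a \<Rightarrow>\<^sub>0 'k) \<Rightarrow> ('a \<times> 'a \<times> 'a \<Rightarrow>\<^sub>0 'k)" where
  "mul3 p q = lin_ext (\<lambda>(x, y, z). lin_ext (\<lambda>(u, v, w). gen (mul x u, mul y v, mul z w)) q) p"

text \<open>One formula serves all three maps: if \<open>p\<close>, \<open>q\<close> represent r, s,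
  then \<open>comul p p\<close>, \<open>comul q q\<close> and \<open>comul p q\<close> represent
  \<delta>_r, \<delta>_s and \<Delta>.\<close>

definition comul :: "('a \<times> 'a \<Rightarrow>\<^sub>0 'k) \<Rightarrow> ('a \<times> 'a \<Rightarrow>\<^sub>0 'k) \<Rightarrow> 'a \<Rightarrow> ('a \<times> 'a \<Rightarrow>\<^sub>0 'k)" where
  "comul p q a = lmul2 a p - rmul2 a q"

section \<open>Actions, legs and products computed on representatives\<close>

lemma lact2_coset:
  "lact2 scale mul a (coset (rel2 scale) p) = coset (rel2 scale) (lmul2 a p)"
  unfolding lact2_def lmul2_def
  by (rule qlift_lin_ext_coset, simp, simp, erule lin_ext_rel2[rotated -1])
    (simp_all add: linear_mod_intros)

lemma ract2_coset:
  "ract2 scale mul (coset (rel2 scale) p) a = coset (rel2 scale) (rmul2 a p)"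
  unfolding ract2_def rmul2_def
  by (rule qlift_lin_ext_coset, simp, simp, erule lin_ext_rel2[rotated -1])
    (simp_all add: linear_mod_intros)

lemma lact3_coset:
  "lact3 scale mul a (coset (rel3 scale) p) = coset (rel3 scale) (lmul3 a p)"
  unfolding lact3_def lmul3_def
  by (rule qlift_lin_ext_coset, simp, simp, erule lin_ext_rel3[rotated -1])
    (simp_all add: linear_mod_intros)

lemma ract3_coset:
  "ract3 scale mul (coset (rel3 scale) p) a = coset (rel3 scale) (rmul3 a p)"
  unfolding ract3_def rmul3_def
  by (rule qlift_lin_ext_coset, simp, simp, erule lin_ext_rel3[rotated -1])
    (simp_all add: linear_mod_intros)

lemma leg12_coset:
  "leg12 scale e (coset (rel2 scale) p) = coset (rel3 scale) (lin_ext (\<lambda>(x, y). gen (x, y, e)) p)"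
  unfolding leg12_def
  by (rule qlift_lin_ext_coset, simp, simp, erule lin_ext_rel2[rotated -1])
    (simp_all add: linear_mod_intros)

lemma leg13_coset:
  "leg13 scale e (coset (rel2 scale) p) = coset (rel3 scale) (lin_ext (\<lambda>(x, y). gen (x, e, y)) p)"
  unfolding leg13_def
  by (rule qlift_lin_ext_coset, simp, simp, erule lin_ext_rel2[rotated -1])
    (simp_all add: linear_mod_intros)

lemma leg23_coset:
  "leg23 scale e (coset (rel2 scale) p) = coset (rel3 scale) (lin_ext (\<lambda>(x, y). gen (e, x, y)) p)"
  unfolding leg23_def
  by (rule qlift_lin_ext_coset, simp, simp, erule lin_ext_rel2[rotated -1])
    (simp_all add: linear_mod_intros)

lemma tmul3_coset:
  "tmul3 scale mul (coset (rel3 scale) p) (coset (rel3 scale) q) = coset (rel3 scale) (mul3 p q)"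
  unfolding tmul3_def mul3_def[symmetric]
proof (rule qlift2_coset)
  fix p' q'
  assume p': "p' - p \<in> rel3 scale" and q': "q' - q \<in> rel3 scale"
  \<comment> \<open>Bilinearity lets one factor change at a time: first \<open>p\<close> to
    \<open>p'\<close> with \<open>q'\<close> fixed, then \<open>q\<close> to \<open>q'\<close> with
    \<open>p\<close> fixed.\<close>
  have "mul3 (p' - p) q' \<in> rel3 scale"
    unfolding mul3_def
    by (rule lin_ext_rel3[OF _ _ _ _ p'])
      (auto simp: case_prod_unfold intro!: linear_mod_intros)
  moreover have "mul3 p (q' - q) \<in> rel3 scale"
    unfolding mul3_def case_prod_unfold
    by (rule lin_ext_mem[OF subspace_rel3], rule lin_ext_rel3[OF _ _ _ _ q'])
      (auto intro!: linear_mod_intros)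
  ultimately have "mul3 (p' - p) q' + mul3 p (q' - q) \<in> rel3 scale"
    by (intro fs.subspace_add subspace_rel3)
  moreover have "mul3 (p' - p) q' + mul3 p (q' - q) = mul3 p' q' - mul3 p q"
    by (simp add: mul3_def case_prod_unfold lin_ext_fun_diff)
  ultimately show "mul3 p' q' - mul3 p q \<in> rel3 scale"
    by simp
qed simp_all

section \<open>Derivation and covariance laws\<close>

lemma comul_mul_left: "comul p q (mul a b) = rmul2 b (comul p q a) + lmul2 a (comul p p b)"
  by (simp add: comul_def lmul2_def rmul2_def case_prod_unfold mul_assoc)

text \<open>The two terms a q b cancel here, as the terms a p b do in \<open>comul_mul_left\<close>.
  The case \<open>p = q\<close> is the derivation law.\<close>

lemma comul_mul_right: "comul p q (mul a b) = lmul2 a (comul p q b) + rmul2 b (comul q q a)"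
  by (simp add: comul_def lmul2_def rmul2_def case_prod_unfold mul_assoc)

lemma linear_mod_comul: "linear_mod scale (rel2 scale) (comul p q)"
  unfolding comul_def[abs_def] lmul2_def rmul2_def case_prod_unfold
  by (intro linear_mod_intros)

lemma tensor2_linear_comul: "tensor2_linear scale (\<lambda>a. coset (rel2 scale) (comul p q a))"
  using linear_mod_comul[of p q]
  by (auto simp: tensor2_linear_def tensor2_def linear_mod_def qadd_coset qscale_coset coset_eq_iff
      diff_diff_eq)

lemma derivation_comul: "derivation scale mul (\<lambda>a. coset (rel2 scale) (comul p p a))"
  by (simp add: derivation_def tensor2_linear_comul lact2_coset ract2_coset qadd_coset
      flip: comul_mul_right)

lemma covariant_derivation_comul:
  "covariant_derivation scale mul (\<lambda>a. coset (rel2 scale) (comul p p a))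
     (\<lambda>a. coset (rel2 scale) (comul q q a)) (\<lambda>a. coset (rel2 scale) (comul p q a))"
  unfolding covariant_derivation_def lact2_coset ract2_coset qadd_coset[OF subspace_rel2]
  by (metis comul_mul_left comul_mul_right)

text \<open>The products of legs that occur in the compatibility equation do not involve the identity.\<close>

definition prod_13_12 ::
    "('a \<times> 'a \<Rightarrow>\<^sub>0 'k) \<Rightarrow> ('a \<times> 'a \<Rightarrow>\<^sub>0 'k) \<Rightarrow> ('a \<times> 'a \<times> 'a \<Rightarrow>\<^sub>0 'k)" where
  "prod_13_12 p q = lin_ext (\<lambda>(x, y). lin_ext (\<lambda>(u, v). gen (mul x u, v, y)) q) p"

definition prod_12_23 ::
    "('a \<times> 'a \<Rightarrow>\<^sub>0 'k) \<Rightarrow> ('a \<times> 'a \<Rightarrow>\<^sub>0 'k) \<Rightarrow> ('a \<times> 'a \<times> 'a \<Rightarrow>\<^sub>0 'k)" where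
  "prod_12_23 p q = lin_ext (\<lambda>(x, y). lin_ext (\<lambda>(u, v). gen (x, mul y u, v)) q) p"

definition prod_23_13 ::
    "('a \<times> 'a \<Rightarrow>\<^sub>0 'k) \<Rightarrow> ('a \<times> 'a \<Rightarrow>\<^sub>0 'k) \<Rightarrow> ('a \<times> 'a \<times> 'a \<Rightarrow>\<^sub>0 'k)" where
  "prod_23_13 p q = lin_ext (\<lambda>(x, y). lin_ext (\<lambda>(u, v). gen (u, x, mul y v)) q) p"

text \<open>The difference of the two sides of the compatibility equation on representatives. Free
  of any identity element, it makes sense in every algebra.\<close>

definition defect ::
    "('a \<times> 'a \<Rightarrow>\<^sub>0 'k) \<Rightarrow> ('a \<times> 'a \<Rightarrow>\<^sub>0 'k) \<Rightarrow> 'a \<Rightarrow> ('a \<times> 'a \<times> 'a \<Rightarrow>\<^sub>0 'k)" where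
  "defect p q a = lmul3 a (prod_13_12 p p - prod_12_23 p p + prod_23_13 q p)
     - rmul3 a (prod_13_12 q p - prod_12_23 q q + prod_23_13 q q)"

lemma compatible_coset_iff:
  assumes "is_identity mul e"
  shows "compatible scale mul e (coset (rel2 scale) p) (coset (rel2 scale) q) a
    \<longleftrightarrow> defect p q a \<in> rel3 scale"
proof -
  have [simp]: "mul e x = x" "mul x e = x" for x
    using assms by (auto simp: is_identity_def)
  \<comment> \<open>In each product, every tensor position has \<open>e\<close> in at least one
    factor, except the position where the two legs overlap.\<close>
  have "mul3 (lin_ext (\<lambda>(x, y). gen (x, e, y)) p) (lin_ext (\<lambda>(x, y). gen (x, y, e)) q) = prod_13_12 p q"
    "mul3 (lin_ext (\<lambda>(x, y). gen (x, y, e)) p) (lin_ext (\<lambda>(x, y). gen (e, x, y)) q) = prod_12_23 p q"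
    "mul3 (lin_ext (\<lambda>(x, y). gen (e, x, y)) p) (lin_ext (\<lambda>(x, y). gen (x, e, y)) q) = prod_23_13 p q"
    for p q
    by (simp_all add: mul3_def prod_13_12_def prod_12_23_def prod_23_13_def case_prod_unfold)
  then show ?thesis
    by (simp add: compatible_def Let_def leg12_coset leg13_coset leg23_coset tmul3_coset
        qadd_coset qdiff_coset lact3_coset ract3_coset coset_eq_iff defect_def)
qed

section \<open>Coassociativity\<close>

text \<open>The arbitrary representative may be replaced by \<open>comul p q x\<close>: the two
  differ by an element of \<open>rel2\<close>, which becomes an element of \<open>rel3\<close> once
  \<open>y\<close> is appended.\<close>

lemma apply_left_coset:
  "apply_left scale (\<lambda>a. coset (rel2 scale) (comul p q a)) (coset (rel2 scale) t)
   = coset (rel3 scale) (lin_ext (\<lambda>(x, y). lin_ext (\<lambda>(u, v). gen (u, v, y)) (comul p q x)) t)"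
    (is "_ = coset _ (lin_ext ?g t)")
proof -
  let ?f = "\<lambda>(x, y). lin_ext (\<lambda>(u, v). gen (u, v, y)) (rep (coset (rel2 scale) (comul p q x)))"
  have "lin_ext (\<lambda>(u, v). gen (u, v, y)) t \<in> rel3 scale" if "t \<in> rel2 scale" for t y
    by (rule lin_ext_rel2[OF _ _ _ that]) (simp_all add: linear_mod_intros)
  then have "?f x - ?g x \<in> rel3 scale" for x
    by (cases x) (simp add: rep_coset_mem flip: lin_ext_diff)
  then have fg: "lin_ext ?f t - lin_ext ?g t \<in> rel3 scale" for t
    by (intro lin_ext_cong_mod subspace_rel3)
  have g: "lin_ext ?g t \<in> rel3 scale" if "t \<in> rel2 scale" for t
    by (rule lin_ext_rel2[OF _ _ _ that])
      (auto simp: comul_def lmul2_def rmul2_def case_prod_unfold intro!: linear_mod_intros)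
  \<comment> \<open>The choice behind \<open>rep\<close> need not be linear in \<open>x\<close>, so
    \<open>?f\<close> inherits well-definedness from \<open>?g\<close>.\<close>
  have "lin_ext ?f t \<in> rel3 scale" if "t \<in> rel2 scale" for t
    using fs.subspace_add[OF subspace_rel3 fg[of t] g[OF that]] by simp
  then have "apply_left scale (\<lambda>a. coset (rel2 scale) (comul p q a)) (coset (rel2 scale) t)
      = coset (rel3 scale) (lin_ext ?f t)"
    unfolding apply_left_def by (intro qlift_lin_ext_coset) simp_all
  also have "\<dots> = coset (rel3 scale) (lin_ext ?g t)"
    by (simp only: coset_eq_iff[OF subspace_rel3] fg)
  finally show ?thesis .
qed

text \<open>Mirror image of \<open>apply_left_coset\<close>, with the fixed entry placed
  first.\<close>

lemma apply_right_coset: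
  "apply_right scale (\<lambda>a. coset (rel2 scale) (comul p q a)) (coset (rel2 scale) t)
   = coset (rel3 scale) (lin_ext (\<lambda>(x, y). lin_ext (\<lambda>(u, v). gen (x, u, v)) (comul p q y)) t)"
    (is "_ = coset _ (lin_ext ?g t)")
proof -
  let ?f = "\<lambda>(x, y). lin_ext (\<lambda>(u, v). gen (x, u, v)) (rep (coset (rel2 scale) (comul p q y)))"
  have "lin_ext (\<lambda>(u, v). gen (y, u, v)) t \<in> rel3 scale" if "t \<in> rel2 scale" for t y
    by (rule lin_ext_rel2[OF _ _ _ that]) (simp_all add: linear_mod_intros)
  then have "?f x - ?g x \<in> rel3 scale" for x
    by (cases x) (simp add: rep_coset_mem flip: lin_ext_diff)
  then have fg: "lin_ext ?f t - lin_ext ?g t \<in> rel3 scale" for t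
    by (intro lin_ext_cong_mod subspace_rel3)
  have g: "lin_ext ?g t \<in> rel3 scale" if "t \<in> rel2 scale" for t
    by (rule lin_ext_rel2[OF _ _ _ that])
      (auto simp: comul_def lmul2_def rmul2_def case_prod_unfold intro!: linear_mod_intros)
  have "lin_ext ?f t \<in> rel3 scale" if "t \<in> rel2 scale" for t
    using fs.subspace_add[OF subspace_rel3 fg[of t] g[OF that]] by simp
  then have "apply_right scale (\<lambda>a. coset (rel2 scale) (comul p q a)) (coset (rel2 scale) t)
      = coset (rel3 scale) (lin_ext ?f t)"
    unfolding apply_right_def by (intro qlift_lin_ext_coset) simp_all
  also have "\<dots> = coset (rel3 scale) (lin_ext ?g t)"
    by (simp only: coset_eq_iff[OF subspace_rel3] fg)
  finally show ?thesis .
qed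

lemma coassociator_eq_defect:
  "lin_ext (\<lambda>(x, y). lin_ext (\<lambda>(u, v). gen (u, v, y)) (comul p q x)) (comul p q a)
   - lin_ext (\<lambda>(x, y). lin_ext (\<lambda>(u, v). gen (x, u, v)) (comul p q y)) (comul p q a)
   = defect p q a"
proof -
  \<comment> \<open>The coassociator expands into eight double sums. \<open>mixed\<close> identifies
    the two occurrences of M, which cancel; \<open>rr\<close>, \<open>s1\<close>, \<open>s2\<close>
    bring a s_23 r_13, s_12 s_23 a and s_23 s_13 a to the nesting used in \<open>defect\<close>. The
    remaining three agree up to associativity.\<close>
  have mixed: "lin_ext (\<lambda>x. lin_ext (\<lambda>u. gen (fst u, mul (snd u) (mul a (fst x)), snd x)) q) p
      = lin_ext (\<lambda>x. lin_ext (\<lambda>u. gen (fst x, mul (snd x) (mul a (fst u)), snd u)) p) q"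
    by (rule lin_ext_swap)
  have rr: "lin_ext (\<lambda>x. lin_ext (\<lambda>u. gen (mul a (fst x), fst u, mul (snd u) (snd x))) q) p
      = lin_ext (\<lambda>x. lin_ext (\<lambda>u. gen (mul a (fst u), fst x, mul (snd x) (snd u))) p) q"
    by (rule lin_ext_swap)
  have s1: "lin_ext (\<lambda>x. lin_ext (\<lambda>u. gen (fst u, mul (snd u) (fst x), mul (snd x) a)) q) q
      = lin_ext (\<lambda>x. lin_ext (\<lambda>u. gen (fst x, mul (snd x) (fst u), mul (snd u) a)) q) q"
    by (rule lin_ext_swap)
  have s2: "lin_ext (\<lambda>x. lin_ext (\<lambda>u. gen (fst x, fst u, mul (snd u) (mul (snd x) a))) q) q
      = lin_ext (\<lambda>x. lin_ext (\<lambda>u. gen (fst u, fst x, mul (snd x) (mul (snd u) a))) q) q"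
    by (rule lin_ext_swap)
  show ?thesis
    by (simp add: defect_def comul_def lmul2_def rmul2_def lmul3_def rmul3_def prod_13_12_def
        prod_12_23_def prod_23_13_def case_prod_unfold lin_ext_fun_diff mul_assoc mixed rr s1)
      (simp add: s2)
qed

lemma coassociative_comul_iff:
  "coassociative scale (\<lambda>a. coset (rel2 scale) (comul p q a))
   \<longleftrightarrow> (\<forall>a. defect p q a \<in> rel3 scale)"
  by (simp add: coassociative_def apply_left_coset apply_right_coset coset_eq_iff
      coassociator_eq_defect)

lemma covariant_bialgebra_coset_iff:
  "covariant_bialgebra scale mul
     (\<lambda>a. qdiff (rel2 scale) (lact2 scale mul a (coset (rel2 scale) p))
       (ract2 scale mul (coset (rel2 scale) p) a))
     (\<lambda>a. qdiff (rel2 scale) (lact2 scale mul a (coset (rel2 scale) q))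
       (ract2 scale mul (coset (rel2 scale) q) a))
     (\<lambda>a. qdiff (rel2 scale) (lact2 scale mul a (coset (rel2 scale) p))
       (ract2 scale mul (coset (rel2 scale) q) a))
   \<longleftrightarrow> (\<forall>a. defect p q a \<in> rel3 scale)"
  unfolding covariant_bialgebra_def lact2_coset ract2_coset qdiff_coset[OF subspace_rel2]
    comul_def[symmetric]
  by (simp add: assoc_algebra_axioms derivation_comul tensor2_linear_comul
      covariant_derivation_comul coassociative_comul_iff)

section \<open>The unital extension\<close>

lemma assoc_algebra_ext: "assoc_algebra (ext_scale scale) (ext_mul scale mul)"
  by unfold_locales
    (auto simp: ext_scale_def ext_mul_def case_prod_unfold prod_eq_iff algebra_simps
      scale_left_distrib scale_right_distrib mul_assoc mul_add_left mul_add_right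
      mul_scale_left mul_scale_right)

lemma is_identity_ext: "is_identity (ext_mul scale mul) (1, 0)"
proof -
  have "mul 0 x = 0" "mul x 0 = 0" for x
    using mul_add_left[of 0 0 x] mul_add_right[of x 0 0] by simp_all
  then show ?thesis
    by (simp add: is_identity_def ext_mul_def case_prod_unfold)
qed

lemma linear_Pair: "Vector_Spaces.linear scale (ext_scale scale) (Pair 0)"
  and linear_snd: "Vector_Spaces.linear (ext_scale scale) scale snd"
  using assoc_algebra.axioms(1)[OF assoc_algebra_ext] vector_space_axioms
  by (unfold Vector_Spaces.linear_iff) (simp_all add: ext_scale_def case_prod_unfold)

lemma ext_embed2_coset:
  "ext_embed2 scale (coset (rel2 scale) p)
   = coset (rel2 (ext_scale scale)) (lin_ext (\<lambda>(x, y). gen ((0, x), (0, y))) p)"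
  unfolding ext_embed2_def
  by (rule qlift_lin_ext_coset, simp, simp, erule lin_ext_rel2[rotated -1])
    (simp_all add: linear_mod_gen_rel2[OF linear_Pair])

text \<open>The second projection \<open>K \<oplus> A \<rightarrow> A\<close> is linear (not multiplicative), which makes
  \<open>A \<otimes> A \<otimes> A\<close> a retract of the threefold tensor power of \<open>K \<oplus> A\<close>.\<close>

lemma rel3_ext_iff:
  "lin_ext (\<lambda>(x, y, z). gen ((0, x), (0, y), (0, z))) t \<in> rel3 (ext_scale scale) \<longleftrightarrow> t \<in> rel3 scale"
    (is "lin_ext ?i t \<in> _ \<longleftrightarrow> _")
proof
  let ?p = "\<lambda>(x, y, z). gen (snd x, snd y, snd z)"
  assume "lin_ext ?i t \<in> rel3 (ext_scale scale)"
  then have "lin_ext ?p (lin_ext ?i t) \<in> rel3 scale"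
    by (rule lin_ext_rel3[rotated -1]) (simp_all add: linear_mod_gen_rel3[OF linear_snd])
  \<comment> \<open>The composite of the two maps sends each generator to itself because
    \<open>snd (0, x) = x\<close>.\<close>
  then show "t \<in> rel3 scale"
    by (simp add: case_prod_unfold)
next
  assume "t \<in> rel3 scale"
  then show "lin_ext ?i t \<in> rel3 (ext_scale scale)"
    by (rule lin_ext_rel3[rotated -1]) (simp_all add: linear_mod_gen_rel3[OF linear_Pair])
qed

text \<open>\<open>Pair 0\<close> is multiplicative and \<open>defect\<close> is built from products
  of entries alone, so the embedding commutes with it.\<close>

lemma defect_ext:
  "assoc_algebra.defect (ext_mul scale mul)
     (lin_ext (\<lambda>(x, y). gen ((0, x), (0, y))) p) (lin_ext (\<lambda>(x, y). gen ((0, x), (0, y))) q) (0, a)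
   = lin_ext (\<lambda>(x, y, z). gen ((0, x), (0, y), (0, z))) (defect p q a)"
proof -
  interpret ext: assoc_algebra "ext_scale scale" "ext_mul scale mul"
    by (rule assoc_algebra_ext)
  have "ext_mul scale mul (0, x) (0, y) = (0, mul x y)" for x y
    by (simp add: ext_mul_def)
  then show ?thesis
    by (simp add: ext.defect_def ext.lmul3_def ext.rmul3_def ext.prod_13_12_def ext.prod_12_23_def
        ext.prod_23_13_def defect_def lmul3_def rmul3_def prod_13_12_def prod_12_23_def
        prod_23_13_def case_prod_unfold)
qed

lemma compatible_ext_coset_iff:
  "compatible (ext_scale scale) (ext_mul scale mul) (1, 0) (ext_embed2 scale (coset (rel2 scale) p))
     (ext_embed2 scale (coset (rel2 scale) q)) (0, a)
   \<longleftrightarrow> defect p q a \<in> rel3 scale"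
  by (simp only: ext_embed2_coset defect_ext rel3_ext_iff
      assoc_algebra.compatible_coset_iff[OF assoc_algebra_ext is_identity_ext])

end

text \<open>Two identities e and f agree, as e = e f = f, so the definite description
  denotes.\<close>

lemma is_identity_identity:
  assumes "unital mul"
  shows "is_identity mul (identity mul)"
proof -
  have "\<exists>!e. is_identity mul e"
    using assms by (metis unital_def is_identity_def)
  then show ?thesis
    unfolding identity_def by (rule theI')
qed

theorem proposition3p15:
  fixes scale :: "'k::field \<Rightarrow> 'a::ab_group_add \<Rightarrow> 'a"
    and mul :: "'a \<Rightarrow> 'a \<Rightarrow> 'a"
    and r s :: "('a \<times> 'a \<Rightarrow>\<^sub>0 'k) set"
  assumes "assoc_algebra scale mul"
    and "r \<in> tensor2 scale" and "s \<in> tensor2 scale"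
  shows "covariant_bialgebra scale mul
           (\<lambda>a. qdiff (rel2 scale) (lact2 scale mul a r) (ract2 scale mul r a))
           (\<lambda>a. qdiff (rel2 scale) (lact2 scale mul a s) (ract2 scale mul s a))
           (\<lambda>a. qdiff (rel2 scale) (lact2 scale mul a r) (ract2 scale mul s a))
     \<longleftrightarrow> (if unital mul
          then \<forall>a. compatible scale mul (identity mul) r s a
          else \<forall>a. compatible (ext_scale scale) (ext_mul scale mul) (1, 0)
                     (ext_embed2 scale r) (ext_embed2 scale s) (0, a))"
proof -
  interpret assoc_algebra scale mul
    by (rule assms)
  obtain p q where "r = coset (rel2 scale) p" "s = coset (rel2 scale) q"
    using assms(2,3) unfolding tensor2_def by blast
  \<comment> \<open>The bialgebra condition and both branches of the conditional reduce to
    \<open>\<forall>a. defect p q a \<in> rel3 scale\<close>.\<close>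
  then show ?thesis
    by (simp add: covariant_bialgebra_coset_iff compatible_coset_iff is_identity_identity
        compatible_ext_coset_iff)
qed

end
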